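(* Let $G$ be a finite simple 2-connected graph with at least four vertices. Then either there exists a vertex $v$ of $G$ such that the graph $G-(v)$, obtained by deleting $v$ and all its incident edges, is 2-connected, or $G$ has at least four vertices of degree $2$.
   Context: All graphs are finite and simple. A simple graph is called 2-connected if it is $K_2$ (2-connected by convention), or it has at least three vertices and deleting any single vertex together with its incident edges leaves a connected graph. *)

theory Defs
  imports "Graph_Theory.Graph_Theory"
begin

text \<open>
  Finite simple graphs are those satisfying the locale predicate \<^const>\<open>graph\<close>: finite symmetric
  digraphs without loops or parallel arcs, so that an undirected edge is a pair of opposite arcs.
  \<open>K\<^bsub>2\<^esub>\<close> counts as 2-connected by convention.
\<close>

definition two_connected :: "('a, 'b) pre_digraph \<Rightarrow> bool" where
  "two_connected G \<longleftrightarrow>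
     K\<^bsub>2\<^esub> G \<or>
     (3 \<le> card (verts G) \<and> (\<forall>v \<in> verts G. connected (pre_digraph.del_vert G v)))"

text \<open>
  Each undirected edge at \<open>v\<close> contributes exactly one arc leaving \<open>v\<close>, so the degree in the
  undirected sense is the out-degree (and not the sum of in- and out-degree).
\<close>

abbreviation degree :: "('a, 'b) pre_digraph \<Rightarrow> 'a \<Rightarrow> nat" where
  "degree G v \<equiv> out_degree G v"

end

theory Submission
  imports Defs
begin

text \<open>
  Suppose that no vertex can be deleted, so that every vertex lies in a separating pair. Call a
  union of some but not all components of \<open>G - p - q\<close> a fragment at \<open>p, q\<close>. Crossing a fragment \<open>F\<close>
  with a separating pair through one of its vertices \<open>x\<close> produces a fragment inside \<open>F - {x}\<close>, unless
  \<open>F = {x}\<close>, in which case \<open>x\<close> has degree 2. By descent every fragment contains a vertex of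
  degree 2, and applying the crossing argument once more at that vertex, every fragment with at
  least two vertices contains two of them. Now take a vertex \<open>x\<close> of degree 2 and a separating pair
  \<open>x, y\<close>: the two sides contribute two vertices of degree 2 each, where a side consisting of a
  single vertex is compensated by \<open>x\<close>, and by \<open>y\<close> if both sides are singletons.
\<close>

section \<open>Fragments and the crossing of separating pairs\<close>

definition fragment :: "'a set \<Rightarrow> ('a \<Rightarrow> 'a \<Rightarrow> bool) \<Rightarrow> 'a \<Rightarrow> 'a \<Rightarrow> 'a set \<Rightarrow> bool" where
  "fragment V E p q B \<longleftrightarrow> p \<in> V \<and> q \<in> V \<and> p \<noteq> q \<and> B \<noteq> {} \<and> B \<subset> V - {p, q} \<and>
     (\<forall>b\<in>B. \<forall>w\<in>V - {p, q} - B. \<not> E b w)"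

text \<open>Connectedness is expressed through edges leaving a vertex set, so that only a vertex set
  and an adjacency relation are needed. \<open>critical\<close> encodes that deleting
  \<open>x\<close> destroys 2-connectedness: some \<open>y\<close> then separates what
  remains.\<close>

locale critical_two_connected =
  fixes V :: "'a set" and E :: "'a \<Rightarrow> 'a \<Rightarrow> bool"
  assumes finite_V: "finite V"
    and E_sym: "E u v \<Longrightarrow> E v u"
    and E_irrefl: "\<not> E u u"
    and no_cut_vertex: "\<lbrakk>v \<in> V; B \<noteq> {}; B \<subset> V - {v}\<rbrakk> \<Longrightarrow> \<exists>b\<in>B. \<exists>w\<in>V - {v} - B. E b w"
    and critical: "x \<in> V \<Longrightarrow> \<exists>y B. fragment V E x y B"
begin

abbreviation frag :: "'a \<Rightarrow> 'a \<Rightarrow> 'a set \<Rightarrow> bool" where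
  "frag \<equiv> fragment V E"

definition deg2 :: "'a set" where
  "deg2 = {v \<in> V. card {w \<in> V. E v w} = 2}"

lemma fragI:
  assumes "p \<in> V" "q \<in> V" "p \<noteq> q" "B \<noteq> {}" "B \<subset> V - {p, q}"
    and "\<And>b w. \<lbrakk>b \<in> B; w \<in> V; E b w\<rbrakk> \<Longrightarrow> w \<in> B \<or> w = p \<or> w = q"
  shows "frag p q B"
  using assms unfolding fragment_def by blast

lemma fragD:
  assumes "frag p q B"
  shows "p \<in> V" "q \<in> V" "p \<noteq> q" "B \<noteq> {}" "B \<subseteq> V" "p \<notin> B" "q \<notin> B" "V - {p, q} - B \<noteq> {}"
    and "\<And>b w. \<lbrakk>b \<in> B; w \<in> V; E b w\<rbrakk> \<Longrightarrow> w \<in> B \<or> w = p \<or> w = q"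
  using assms unfolding fragment_def by blast+

lemma frag_commute: "frag p q B \<Longrightarrow> frag q p B"
  unfolding fragment_def by (auto simp: insert_commute)

lemma frag_complement:
  assumes "frag p q B"
  shows "frag p q (V - {p, q} - B)"
  using fragD[OF assms] E_sym by (intro fragI) blast+

lemma not_isolated_by_vertex:
  assumes "v \<in> V" "B \<noteq> {}" "B \<subset> V - {v}"
    and "\<And>b w. \<lbrakk>b \<in> B; w \<in> V; E b w\<rbrakk> \<Longrightarrow> w \<in> B \<or> w = v"
  shows False
  using no_cut_vertex[OF assms(1-3)] assms(4) by blast

text \<open>Otherwise \<open>q\<close> alone would separate \<open>B\<close> from \<open>p\<close>,
  making \<open>q\<close> a cut vertex.\<close>

lemma frag_adjacent_left:
  assumes "frag p q B"
  shows "\<exists>b\<in>B. E b p"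
proof -
  have "B \<subset> V - {q}" using fragD[OF assms] by blast
  then show ?thesis
    using not_isolated_by_vertex[of q B] fragD[OF assms] by metis
qed

lemma frag_singleton_nbrs:
  assumes "frag p q {z}"
  shows "{w \<in> V. E z w} = {p, q}"
  using frag_adjacent_left[OF assms] frag_adjacent_left[OF frag_commute[OF assms]] fragD[OF assms]
    E_irrefl by blast

lemma frag_singleton_deg2: "frag p q {z} \<Longrightarrow> z \<in> deg2"
  using frag_singleton_nbrs[of p q z] fragD(3,5)[of p q "{z}"] unfolding deg2_def by simp

text \<open>The pairs \<open>x\<close>, \<open>y\<close> and \<open>s\<close>, \<open>t\<close> cut
  the remaining vertices into four corners, the intersections of \<open>A\<close> or its opposite
  side with \<open>F\<close> or its opposite side. A corner attached to at most one vertex is empty.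
  The position of \<open>y\<close> and \<open>t\<close> then decides whether a corner in
  \<open>F\<close> or the whole of \<open>A'\<close> is the required fragment.\<close>

lemma crossing_fragment:
  assumes F: "frag s t F" and x: "x \<in> F" "F \<noteq> {x}" and A: "frag x y A" and s: "s \<in> A"
  shows "\<exists>p q B. frag p q B \<and> B \<subseteq> F - {x}"
proof -
  define A' where "A' = V - {x, y} - A"
  define F' where "F' = V - {s, t} - F"
  have A': "frag x y A'" and F': "frag s t F'"
    unfolding A'_def F'_def using A F by (simp_all add: frag_complement)
  note FD = fragD[OF F] and AD = fragD[OF A] and FD' = fragD[OF F'] and AD' = fragD[OF A']
  have V_A: "V = A \<union> A' \<union> {x, y}" and V_F: "V = F \<union> F' \<union> {s, t}"
    and dis: "A \<inter> A' = {}" "F \<inter> F' = {}"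
    unfolding A'_def F'_def using FD(1,2,5) AD(1,2,5) by blast+
  have AV: "A \<subseteq> V - {x, y}" "A' \<subseteq> V - {x, y}" and FV: "F \<subseteq> V - {s, t}" "F' \<subseteq> V - {s, t}"
    using AD(5-7) AD'(5-7) FD(5-7) FD'(5-7) by blast+
  \<comment> \<open>A neighbour outside the corner \<open>C \<inter> H\<close> lies in
    \<open>C \<inter> {s, t}\<close>, in \<open>H \<inter> {x, y}\<close> or in both pairs. If only
    \<open>v\<close> is possible, a nonempty corner would make \<open>v\<close> a cut
    vertex.\<close>
  have corner: "C \<inter> H = {}"
    if C: "C = A \<or> C = A'" and H: "H = F \<or> H = F'" and v: "v \<in> V" "v \<notin> C \<inter> H"
      and nb: "C \<inter> {s, t} \<subseteq> {v}" "H \<inter> {x, y} \<subseteq> {v}" "{x, y} \<inter> {s, t} \<subseteq> {v}" for C H v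
  proof (rule ccontr)
    assume ne: "C \<inter> H \<noteq> {}"
    have "C \<inter> H \<subset> V - {v}"
      using C v AD(1-3) AV by blast
    moreover have "w \<in> C \<inter> H \<or> w = v" if "b \<in> C \<inter> H" "w \<in> V" "E b w" for b w
    proof -
      have "w \<in> C \<or> w = x \<or> w = y" using that C AD(9)[of b w] AD'(9)[of b w] by blast
      moreover have "w \<in> H \<or> w = s \<or> w = t" using that H FD(9)[of b w] FD'(9)[of b w] by blast
      ultimately show ?thesis using nb by blast
    qed
    ultimately show False using not_isolated_by_vertex[OF v(1) ne] by blast
  qed
  \<comment> \<open>With \<open>y\<close> outside \<open>F\<close>, a corner in \<open>F\<close> can
    be attached only to \<open>x\<close> and \<open>v\<close>, so it is a fragment as soon as it is
    nonempty.\<close>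
  have corner_frag: "\<exists>p q B. frag p q B \<and> B \<subseteq> F - {x}"
    if C: "C = A \<or> C = A'" and v: "v \<in> V" "v \<notin> C \<inter> F" "v \<noteq> x" and ne: "C \<inter> F \<noteq> {}"
      and nb: "C \<inter> {s, t} \<subseteq> {v}" "y \<notin> F" "{x, y} \<inter> {s, t} \<subseteq> {v}" for C v
  proof -
    \<comment> \<open>Whichever of \<open>s\<close>, \<open>t\<close> differs from \<open>v\<close>
      lies outside \<open>F\<close> and shows that the inclusion is proper.\<close>
    have "\<exists>u. u \<in> V - {x, v} \<and> u \<notin> C \<inter> F"
    proof -
      have "s \<in> V - {x}" "t \<in> V - {x}" "s \<notin> F" "t \<notin> F" "s \<noteq> t" using FD(1-3) FV x by blast+
      then show ?thesis by (cases "s = v") auto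
    qed
    moreover have "C \<inter> F \<subseteq> V - {x, v}" using C v AV FD(5) x by blast
    ultimately have "C \<inter> F \<subset> V - {x, v}" by blast
    moreover have "w \<in> C \<inter> F \<or> w = x \<or> w = v" if "b \<in> C \<inter> F" "w \<in> V" "E b w" for b w
    proof -
      have "w \<in> C \<or> w = x \<or> w = y" using that C AD(9)[of b w] AD'(9)[of b w] by blast
      moreover have "w \<in> F \<or> w = s \<or> w = t" using that FD(9)[of b w] by blast
      ultimately show ?thesis using nb by blast
    qed
    ultimately have "frag x v (C \<inter> F)"
      using v ne AD(1) by (intro fragI) auto
    then show ?thesis using C AD(6) AD'(6) by blast
  qed
  have xF': "x \<notin> F'" and xst: "x \<noteq> s" "x \<noteq> t" using x FV dis by blast+
  have ys: "y \<noteq> s" using s AV by blast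
  consider "y \<in> F" | "y = t" | "y \<in> F'" using V_F AD(2) ys by blast
  then show ?thesis
  proof cases
    case 1
    then have yF': "y \<notin> F'" and yt: "y \<noteq> t" using dis FV by blast+
    show ?thesis
    proof (cases "t \<in> A")
      case True
      \<comment> \<open>This corner has no attachment at all, so any vertex outside it, here
        \<open>x\<close>, serves as \<open>v\<close>. Hence \<open>A'\<close> itself lies inside
        \<open>F\<close>.\<close>
      have "A' \<inter> F' = {}"
        by (rule corner[of A' F' x]) (use s True dis AD(1-3) AV xF' yF' xst ys yt in blast)+
      then have "A' \<subseteq> F - {x}" using V_F AV dis s True by blast
      then show ?thesis using A' by blast
    next
      case False
      then have "t \<in> A'" using V_A FD(2) xst yt by blast
      \<comment> \<open>The two corners in \<open>F'\<close> are attached only to \<open>s\<close>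
        and only to \<open>t\<close>, so both vanish, which is absurd.\<close>
      have "A \<inter> F' = {}"
        by (rule corner[of A F' s]) (use False FD(1-3) FV xF' yF' xst ys yt in blast)+
      moreover have "A' \<inter> F' = {}"
        by (rule corner[of A' F' t]) (use s dis FD(1-3) FV xF' yF' xst ys yt in blast)+
      ultimately have "F' = {}" using V_A FV xF' yF' by blast
      then show ?thesis using FD'(4) by blast
    qed
  next
    case 2
    have sA': "s \<notin> A'" and yF: "y \<notin> F" and yF': "y \<notin> F'" using s dis 2 FV by blast+
    show ?thesis
    proof (cases "A' \<inter> F = {}")
      case True
      have "A' \<inter> F' = {}"
        by (rule corner[of A' F' t]) (use sA' 2 FD(1-3) FV xF' yF' xst ys in blast)+
      then have "A' = {}" using True V_F sA' 2 AV by blast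
      then show ?thesis using AD'(4) by blast
    next
      case False
      show ?thesis
        by (rule corner_frag[of A' t]) (use False sA' 2 FD(1-3) FV yF xst ys in blast)+
    qed
  next
    case 3
    then have yF: "y \<notin> F" and yt: "y \<noteq> t" using dis FV by blast+
    show ?thesis
    proof (cases "t \<in> A")
      case True
      have nA': "s \<notin> A'" "t \<notin> A'" using s True dis by blast+
      have "A' \<inter> F = {}"
        by (rule corner[of A' F x]) (use nA' AD(1-3) AV yF xst ys yt in blast)+
      moreover have "A' \<inter> F' = {}"
        by (rule corner[of A' F' y]) (use nA' AD(1-3) AV xF' xst ys yt in blast)+
      ultimately have "A' = {}" using V_F nA' AV by blast
      then show ?thesis using AD'(4) by blast
    next
      case False
      have sA': "s \<notin> A'" using s dis by blast
      \<comment> \<open>Here \<open>F \<noteq> {x}\<close> enters: a second vertex of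
        \<open>F\<close> is not \<open>y\<close>, so it lies in \<open>A\<close> or
        \<open>A'\<close>.\<close>
      have "A \<inter> F \<noteq> {} \<or> A' \<inter> F \<noteq> {}"
        using x V_A FD(5) yF by blast
      then show ?thesis
      proof
        assume ne: "A \<inter> F \<noteq> {}"
        show ?thesis
          by (rule corner_frag[of A s]) (use False ne FD(1-3) FV yF xst ys yt in blast)+
      next
        assume ne: "A' \<inter> F \<noteq> {}"
        show ?thesis
          by (rule corner_frag[of A' t]) (use sA' ne FD(1-3) FV yF xst ys yt in blast)+
      qed
    qed
  qed
qed

text \<open>At most one of \<open>s\<close>, \<open>t\<close> equals \<open>y\<close>, so the other
  lies on one side of the pair \<open>x\<close>, \<open>y\<close>. Exchanging \<open>s\<close> with
  \<open>t\<close>, or \<open>A\<close> with its complement, gives the situation of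
  \<open>crossing_fragment\<close>.\<close>

lemma smaller_fragment:
  assumes F: "frag s t F" and x: "x \<in> F" "F \<noteq> {x}"
  shows "\<exists>p q B. frag p q B \<and> B \<subseteq> F - {x}"
proof -
  have "x \<in> V" using x fragD(5)[OF F] by blast
  then obtain y A where A: "frag x y A" using critical by blast
  let ?A' = "V - {x, y} - A"
  have A': "frag x y ?A'" using frag_complement[OF A] .
  have "s \<noteq> t" and st: "s \<in> V - {x}" "t \<in> V - {x}" using fragD[OF F] x by auto
  then consider "s \<in> A" | "s \<in> ?A'" | "t \<in> A" | "t \<in> ?A'" by blast
  then show ?thesis
    using crossing_fragment[OF F x A] crossing_fragment[OF F x A']
      crossing_fragment[OF frag_commute[OF F] x A] crossing_fragment[OF frag_commute[OF F] x A']
    by cases auto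
qed

section \<open>Vertices of degree 2 in fragments\<close>

lemma finite_fragment: "frag p q F \<Longrightarrow> finite F"
  using fragD(5) finite_subset finite_V by metis

lemma fragment_contains_deg2: "frag p q F \<Longrightarrow> F \<inter> deg2 \<noteq> {}"
proof (induction "card F" arbitrary: p q F rule: less_induct)
  case less
  obtain x where x: "x \<in> F" using fragD(4)[OF less.prems] by blast
  show ?case
  proof (cases "F = {x}")
    case True
    then show ?thesis using frag_singleton_deg2 less.prems by blast
  next
    case False
    then obtain r s B where B: "frag r s B" "B \<subseteq> F - {x}"
      using smaller_fragment[OF less.prems x] by blast
    then have "card B < card F"
      using x finite_fragment[OF less.prems] by (intro psubset_card_mono) auto
    then show ?thesis using less.hyps B by blast
  qed
qed

text \<open>Removing a degree 2 vertex \<open>x\<close> leaves room for a fragment avoiding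
  \<open>x\<close>, which supplies the second one.\<close>

lemma fragment_contains_two_deg2:
  assumes "frag p q F" "\<And>z. F \<noteq> {z}"
  shows "2 \<le> card (F \<inter> deg2)"
proof -
  obtain x where x: "x \<in> F" "x \<in> deg2" using fragment_contains_deg2[OF assms(1)] by blast
  obtain r s B where B: "frag r s B" "B \<subseteq> F - {x}"
    using smaller_fragment[OF assms(1) x(1) assms(2)] by blast
  obtain z where z: "z \<in> B" "z \<in> deg2" using fragment_contains_deg2[OF B(1)] by blast
  have "{x, z} \<subseteq> F \<inter> deg2" "x \<noteq> z" using x z B by blast+
  then show ?thesis
    using card_mono[of "F \<inter> deg2" "{x, z}"] finite_fragment[OF assms(1)] by simp
qed

lemma four_le_card_deg2:
  assumes "V \<noteq> {}"
  shows "4 \<le> card deg2"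
proof -
  have fin: "finite deg2" unfolding deg2_def using finite_V by simp
  obtain x0 where "x0 \<in> V" using assms by blast
  then obtain y0 B0 where "frag x0 y0 B0" using critical by blast
  then obtain x where x: "x \<in> deg2" using fragment_contains_deg2 by blast
  then have "x \<in> V" unfolding deg2_def by blast
  then obtain y A where A: "frag x y A" using critical by blast
  define A' where "A' = V - {x, y} - A"
  have A': "frag x y A'" unfolding A'_def using frag_complement[OF A] .
  have dis: "A \<inter> A' = {}" and V: "V = A \<union> A' \<union> {x, y}"
    unfolding A'_def using fragD[OF A] by blast+
  \<comment> \<open>The four vertices are \<open>a\<close>, \<open>x\<close> and two from
    \<open>B\<close>.\<close>
  have one_singleton: "4 \<le> card deg2"
    if "frag x y {a}" "frag x y B" "a \<notin> B" "\<And>z. B \<noteq> {z}" for a B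
  proof -
    have B: "2 \<le> card (B \<inter> deg2)" "x \<notin> B" "finite B"
      using that fragment_contains_two_deg2 fragD(6) finite_fragment by blast+
    have "a \<noteq> x" using fragD(6)[OF that(1)] by blast
    then have "4 \<le> card (insert a (insert x (B \<inter> deg2)))"
      using B that(3) by simp
    also have "\<dots> \<le> card deg2"
      using x frag_singleton_deg2[OF that(1)] fin by (intro card_mono) auto
    finally show ?thesis .
  qed
  show ?thesis
  proof (cases "\<exists>a. A = {a}")
    case True
    then obtain a where a: "A = {a}" by blast
    show ?thesis
    proof (cases "\<exists>b. A' = {b}")
      case True
      then obtain b where b: "A' = {b}" by blast
      have Ea: "{w \<in> V. E a w} = {x, y}" and Eb: "{w \<in> V. E b w} = {x, y}"
        using frag_singleton_nbrs A A' a b by blast+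
      have ab: "a \<noteq> b" and Vab: "V = {a, b, x, y}" and ne: "x \<noteq> y" "a \<noteq> x" "a \<noteq> y" "b \<noteq> x" "b \<noteq> y"
        using dis V a b fragD[OF A] fragD[OF A'] by auto
      have "E a x" "E a y" "E b x" "E b y" using Ea Eb Vab by blast+
      then have xy: "E x a" "E x b" "E y a" "E y b" using E_sym by blast+
      \<comment> \<open>The neighbours \<open>a\<close> and \<open>b\<close> already exhaust the
        degree of \<open>x\<close>, so the graph is a 4-cycle and \<open>y\<close> has degree 2 as
        well.\<close>
      have "\<not> E x y"
      proof
        assume "E x y"
        then have "{a, b, y} \<subseteq> {w \<in> V. E x w}" using xy Vab by blast
        then have "3 \<le> card {w \<in> V. E x w}"
          using card_mono[of "{w \<in> V. E x w}" "{a, b, y}"] finite_V ab ne by simp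
        then show False using x unfolding deg2_def by simp
      qed
      then have "{w \<in> V. E y w} = {a, b}" using xy Vab E_irrefl E_sym by blast
      then have "y \<in> deg2" using ab Vab unfolding deg2_def by simp
      then have "{a, b, x, y} \<subseteq> deg2" using x frag_singleton_deg2 A A' a b by blast
      then show ?thesis
        using card_mono[OF fin, of "{a, b, x, y}"] ab ne by simp
    next
      case False
      then show ?thesis using one_singleton[of a A'] A A' a dis by blast
    qed
  next
    case nA: False
    show ?thesis
    proof (cases "\<exists>b. A' = {b}")
      case True
      then show ?thesis using one_singleton[of _ A] A A' nA dis by blast
    next
      case False
      have "2 + 2 \<le> card (A \<inter> deg2) + card (A' \<inter> deg2)"
        using fragment_contains_two_deg2 A A' nA False by (intro add_mono) blast+
      also have "\<dots> = card (A \<inter> deg2 \<union> A' \<inter> deg2)"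
        using dis fin by (intro card_Un_disjoint[symmetric]) auto
      also have "\<dots> \<le> card deg2" using fin by (intro card_mono) auto
      finally show ?thesis by simp
    qed
  qed
qed

end

section \<open>Translation between digraphs and the adjacency relation\<close>

lemma (in sym_digraph) connected_iff_crossing_arc:
  "connected G \<longleftrightarrow> verts G \<noteq> {} \<and>
     (\<forall>B. B \<noteq> {} \<and> B \<subset> verts G \<longrightarrow> (\<exists>b\<in>B. \<exists>w\<in>verts G - B. b \<rightarrow>\<^bsub>G\<^esub> w))"
proof -
  have "connected G \<longleftrightarrow> strongly_connected G"
    unfolding connected_def strongly_connected_def
    using reachable_mk_symmetric_eq[OF sym_arcs] by simp
  also have "\<dots> \<longleftrightarrow> verts G \<noteq> {} \<and>
     (\<forall>B. B \<noteq> {} \<and> B \<subset> verts G \<longrightarrow> (\<exists>b\<in>B. \<exists>w\<in>verts G - B. b \<rightarrow>\<^bsub>G\<^esub> w))" (is "?L \<longleftrightarrow> ?R")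
  proof
    assume L: ?L
    show ?R
    proof (intro conjI allI impI)
      show "verts G \<noteq> {}" using L unfolding strongly_connected_def by blast
      fix B assume B: "B \<noteq> {} \<and> B \<subset> verts G"
      then obtain b v where bv: "b \<in> B" "v \<in> verts G - B" by blast
      show "\<exists>b\<in>B. \<exists>w\<in>verts G - B. b \<rightarrow>\<^bsub>G\<^esub> w"
      proof (rule ccontr)
        assume closed: "\<not> ?thesis"
        have "b \<rightarrow>\<^sup>* v" using L bv B unfolding strongly_connected_def by blast
        then have "v \<in> B"
        proof (induction rule: reachable_induct)
          case base
          then show ?case using bv by blast
        next
          case (step y z)
          then show ?case using closed by (meson DiffI adj_in_verts(2))
        qed
        then show False using bv by blast
      qed
    qed
  next
    assume R: ?R
    show ?L
    proof (rule strongly_connectedI)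
      show "verts G \<noteq> {}" using R by blast
      fix u v assume uv: "u \<in> verts G" "v \<in> verts G"
      \<comment> \<open>The set reachable from \<open>u\<close> has no leaving arc, so it cannot be
        a proper subset.\<close>
      let ?B = "{w \<in> verts G. u \<rightarrow>\<^sup>* w}"
      have "u \<in> ?B" using uv by simp
      moreover have "\<not> (\<exists>b\<in>?B. \<exists>w\<in>verts G - ?B. b \<rightarrow>\<^bsub>G\<^esub> w)"
        using reachable_adj_trans by blast
      ultimately have "\<not> ?B \<subset> verts G" using R by (metis (no_types, lifting) empty_iff)
      then show "u \<rightarrow>\<^sup>* v" using uv by blast
    qed
  qed
  finally show ?thesis .
qed

lemma (in pre_digraph) arcs_ends_del_vert:
  "arcs_ends (del_vert v) = {(u, w) \<in> arcs_ends G. u \<noteq> v \<and> w \<noteq> v}"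
  unfolding arcs_ends_conv by (auto simp: del_vert_simps)

lemma (in sym_digraph) sym_digraph_del_vert: "sym_digraph (del_vert v)"
proof -
  have "symmetric (del_vert v)"
    using sym_arcs unfolding symmetric_def sym_def arcs_ends_del_vert by blast
  then show ?thesis using wf_digraph.sym_digraphI[OF wf_digraph_del_vert] by blast
qed

text \<open>Without parallel arcs, \<open>head G\<close> is injective on the arcs leaving
  \<open>v\<close>.\<close>

lemma (in nomulti_digraph) out_degree_eq_card_nbrs:
  "out_degree G v = card {w \<in> verts G. v \<rightarrow>\<^bsub>G\<^esub> w}"
proof -
  have "inj_on (head G) (out_arcs G v)"
    using no_multi_arcs by (auto simp: inj_on_def arc_to_ends_def)
  moreover have "head G ` out_arcs G v = {w \<in> verts G. v \<rightarrow>\<^bsub>G\<^esub> w}"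
    by (auto simp: arcs_ends_conv)
  ultimately show ?thesis unfolding out_degree_def by (metis card_image)
qed

theorem theorem2:
  fixes G :: "('a, 'b) pre_digraph"
  assumes "graph G"
    and "two_connected G"
    and "4 \<le> card (verts G)"
  shows "(\<exists>v \<in> verts G. two_connected (pre_digraph.del_vert G v)) \<or>
         4 \<le> card {v \<in> verts G. degree G v = 2}"
proof (cases "\<exists>v \<in> verts G. two_connected (pre_digraph.del_vert G v)")
  case True
  then show ?thesis ..
next
  case not_ex: False
  interpret graph G by fact
  interpret critical_two_connected "verts G" "dominates G"
  proof unfold_locales
    show "finite (verts G)" by simp
    show "u \<rightarrow>\<^bsub>G\<^esub> v \<Longrightarrow> v \<rightarrow>\<^bsub>G\<^esub> u" for u v using arcs_ends_symmetric[OF sym_arcs] .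
    show "\<not> u \<rightarrow>\<^bsub>G\<^esub> u" for u using adj_not_same by blast
    show "\<exists>b\<in>B. \<exists>w\<in>verts G - {v} - B. b \<rightarrow>\<^bsub>G\<^esub> w"
      if "v \<in> verts G" "B \<noteq> {}" "B \<subset> verts G - {v}" for v B
    proof -
      have "connected (del_vert v)"
        using assms(2,3) that(1) unfolding two_connected_def complete_digraph_def by auto
      then have "\<exists>b\<in>B. \<exists>w\<in>verts (del_vert v) - B. b \<rightarrow>\<^bsub>del_vert v\<^esub> w"
        using that sym_digraph.connected_iff_crossing_arc[OF sym_digraph_del_vert[of v]]
        by (simp add: verts_del_vert)
      then show ?thesis by (auto simp: arcs_ends_del_vert verts_del_vert)
    qed
    show "\<exists>y B. fragment (verts G) (dominates G) x y B" if x: "x \<in> verts G" for x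
    proof -
      let ?H = "del_vert x"
      interpret H: sym_digraph ?H by (rule sym_digraph_del_vert)
      have card_H: "3 \<le> card (verts ?H)" using assms(3) x by (simp add: verts_del_vert)
      \<comment> \<open>Since \<open>?H\<close> still has three vertices, it can fail to be
        2-connected only through a cut vertex \<open>y\<close>.\<close>
      then obtain y where y: "y \<in> verts ?H" and nc: "\<not> connected (H.del_vert y)"
        using not_ex x unfolding two_connected_def by blast
      have vH: "verts (H.del_vert y) = verts G - {x, y}"
        by (auto simp: H.verts_del_vert verts_del_vert)
      have "card (verts (H.del_vert y)) \<noteq> 0"
        using card_H y by (simp add: H.verts_del_vert)
      then have "verts (H.del_vert y) \<noteq> {}" by force
      then obtain B where B: "B \<noteq> {}" "B \<subset> verts G - {x, y}"
        "\<not> (\<exists>b\<in>B. \<exists>w\<in>verts G - {x, y} - B. b \<rightarrow>\<^bsub>H.del_vert y\<^esub> w)"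
        using nc sym_digraph.connected_iff_crossing_arc[OF H.sym_digraph_del_vert[of y]]
        unfolding vH by blast
      then have "\<not> b \<rightarrow>\<^bsub>G\<^esub> w" if "b \<in> B" "w \<in> verts G - {x, y} - B" for b w
        using that unfolding H.arcs_ends_del_vert arcs_ends_del_vert by blast
      then have "fragment (verts G) (dominates G) x y B"
        using B x y unfolding fragment_def by (auto simp: verts_del_vert)
      then show ?thesis by blast
    qed
  qed
  have "4 \<le> card {v \<in> verts G. degree G v = 2}"
    using four_le_card_deg2 assms(3) unfolding deg2_def out_degree_eq_card_nbrs by force
  then show ?thesis ..
qed

end
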